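(* Let $c : \mathbf{R}^d \times \mathbf{R}^d \to \mathbf{R}$ satisfy: (i) $c$ is bounded; (ii) there is a Lebesgue negligible closed set $Z \subset \mathbf{R}^d \times \mathbf{R}^d$ such that $c \in C^2\big((\mathbf{R}^d \times \mathbf{R}^d) \setminus Z\big)$; and (iii) $\det\big[D^2_{x^i y^j} c(x,y)\big]_{i,j=1}^d \ne 0$ for all $(x,y) \in (\mathbf{R}^d \times \mathbf{R}^d) \setminus Z$. Fix $0 \le \bar h \in L^1(\mathbf{R}^d \times \mathbf{R}^d)$ and take $0 \le f, g \in L^1(\mathbf{R}^d)$ such that $\Gamma := \Gamma(f,g)^{\bar h} \ne \emptyset$. Then the minimum $\min_{k \in \Gamma} c[k]$ is uniquely attained: there is exactly one $h \in \Gamma$ (up to almost everywhere equality) with $c[h] = \min_{k\in\Gamma} c[k]$.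
   Context: For $0 \le f, g \in L^1(\mathbf{R}^d)$ with $\int f = \int g$ and $0 \le \bar h \in L^1(\mathbf{R}^d \times \mathbf{R}^d)$, the set $\Gamma(f,g)^{\bar h}$ consists of all $0 \le h \in L^1(\mathbf{R}^d \times \mathbf{R}^d)$ (functions identified when equal Lebesgue-a.e.) such that $\int_{\mathbf{R}^d} h(x,\tilde y)\,d\tilde y = f(x)$ for Lebesgue-a.e. $x$, $\int_{\mathbf{R}^d} h(\tilde x,y)\,d\tilde x = g(y)$ for Lebesgue-a.e. $y$, and $h \le \bar h$ almost everywhere. The transportation cost of $h$ is $c[h] := \int_{\mathbf{R}^d \times \mathbf{R}^d} c(x,y) h(x,y)\,dx\,dy$. $D^2_{x^i y^j} c = \partial^2 c / \partial x^i \partial y^j$ denotes the mixed second partial derivatives. *)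

theory Defs
  imports "HOL-Analysis.Analysis"
begin

text \<open>Twice continuously Frechet differentiable on \<open>U\<close>, with the second derivative as a
  bounded bilinear map in curried form. The derivatives are unrestricted (\<open>at z\<close>), so the
  notion is the usual one for open \<open>U\<close>. Continuity of \<open>f\<close> and \<open>f'\<close> on \<open>U\<close> follows from
  differentiability.\<close>

definition C2_on :: "('a::real_normed_vector \<Rightarrow> 'b::real_normed_vector) \<Rightarrow> 'a set \<Rightarrow> bool"
  where
  "C2_on f U \<longleftrightarrow>
     (\<exists>(f' :: 'a \<Rightarrow> 'a \<Rightarrow>\<^sub>L 'b) (f'' :: 'a \<Rightarrow> 'a \<Rightarrow>\<^sub>L 'a \<Rightarrow>\<^sub>L 'b).
        (\<forall>z\<in>U. (f has_derivative blinfun_apply (f' z)) (at z)) \<and>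
        (\<forall>z\<in>U. (f' has_derivative blinfun_apply (f'' z)) (at z)) \<and>
        continuous_on U f'')"

definition mixed_partials ::
  "((real^'d) \<times> (real^'d) \<Rightarrow> real) \<Rightarrow> real^'d \<Rightarrow> real^'d \<Rightarrow> real^'d^'d" where
  "mixed_partials c x y =
     (\<chi> i j. deriv (\<lambda>s. deriv (\<lambda>t. c (x + s *\<^sub>R axis i 1, y + t *\<^sub>R axis j 1)) 0) 0)"

text \<open>Elements of \<open>L\<^sup>1\<close> are represented by integrable functions on the completed measure
  \<^const>\<open>lebesgue\<close>. Pointwise conditions are imposed almost everywhere, so \<open>transport_plans\<close> is
  closed under almost everywhere equality and stands for a set of equivalence classes.
  Sections \<open>h (x, \<cdot>)\<close> are integrable for almost every \<open>x\<close> only, as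
  \<^const>\<open>has_bochner_integral\<close> under the quantifier records.\<close>

definition nonneg_L1 :: "('a::euclidean_space \<Rightarrow> real) \<Rightarrow> bool" where
  "nonneg_L1 f \<longleftrightarrow> integrable lebesgue f \<and> (AE x in lebesgue. 0 \<le> f x)"

definition transport_plans ::
  "(real^'d \<Rightarrow> real) \<Rightarrow> (real^'d \<Rightarrow> real) \<Rightarrow> ((real^'d) \<times> (real^'d) \<Rightarrow> real)
     \<Rightarrow> ((real^'d) \<times> (real^'d) \<Rightarrow> real) set" where
  "transport_plans f g hbar =
     {h. nonneg_L1 h \<and>
         (AE x in lebesgue. has_bochner_integral lebesgue (\<lambda>y. h (x, y)) (f x)) \<and>
         (AE y in lebesgue. has_bochner_integral lebesgue (\<lambda>x. h (x, y)) (g y)) \<and>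
         (AE z in lebesgue. h z \<le> hbar z)}"

definition transport_cost ::
  "((real^'d) \<times> (real^'d) \<Rightarrow> real) \<Rightarrow> ((real^'d) \<times> (real^'d) \<Rightarrow> real) \<Rightarrow> real" where
  "transport_cost c h = (LINT z|lebesgue. c z * h z)"

end

theory Submission imports Defs begin

text \<open>
  Existence. The admissible plans form a convex set of functions lying between \<open>0\<close> and the
  integrable capacity \<open>hbar\<close>, and this set is closed under almost everywhere limits: the marginal
  constraints survive by dominated convergence on almost every section. The cost is a bounded
  linear functional on it. In place of weak compactness one uses the strictly convex functional
  \<open>Q k = \<integral> k\<^sup>2 / hbar\<close>: almost minimizing \<open>Q\<close> on a decreasing sequence of sublevel sets of
  the cost gives, by the parallelogram law, a Cauchy sequence in \<open>L\<^sup>1\<close>, whose limit is optimal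
  (\<open>minimum_attained_on_AE_closed_midpoint_convex_set\<close>).

  Uniqueness. Every optimal plan \<open>h\<close> equals \<open>0\<close> or \<open>hbar\<close> almost everywhere
  (\<open>optimal_plan_saturates_capacity\<close>). Applied to the midpoint of two optimal plans, which is
  again optimal, this makes the two plans agree: where the midpoint is \<open>0\<close> both vanish, and
  where it is \<open>hbar\<close> both equal \<open>hbar\<close>.

  Saturation. Suppose that \<open>\<delta> \<le> h \<le> hbar - \<delta>\<close> on a set of positive measure. Nondegeneracy supplies
  a point of that set and coordinates \<open>i\<close>, \<open>j\<close> such that the mixed partial of \<open>c\<close> in \<open>x\<^sub>i\<close> and \<open>y\<^sub>j\<close>
  keeps one sign nearby, and near it a compact non-negligible part \<open>K\<close> of the set. For small
  shifts \<open>p\<close> in direction \<open>x\<^sub>i\<close> and \<open>q\<close> in direction \<open>y\<^sub>j\<close>, the set \<open>F\<close> of those points whose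
  translates by \<open>p\<close>, \<open>q\<close> and \<open>p + q\<close> all stay in \<open>K\<close> is not negligible
  (\<open>translates_of_compact_intersect\<close>). Moving mass between the four translates,
  \<open>1_F(z) - 1_F(z - p) - 1_F(z - q) + 1_F(z - p - q)\<close>, leaves both marginals unchanged because
  Lebesgue measure is translation invariant (\<open>corner_exchange_marginals\<close>), and it changes the cost
  by the integral over \<open>F\<close> of the second difference of \<open>c\<close>, which is nonzero
  (\<open>second_difference_sign\<close>). A small multiple of suitable sign lowers the cost, a contradiction.
\<close>

section \<open>Minimizing a bounded linear functional below an integrable bound\<close>

lemma integrable_bounded_mult:
  fixes c :: "'a \<Rightarrow> real"
  assumes "integrable M k" "c \<in> borel_measurable M" "\<And>z. \<bar>c z\<bar> \<le> C"
  shows "integrable M (\<lambda>z. c z * k z)"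
proof -
  have "integrable M (\<lambda>z. C * k z)" using assms(1) by simp
  moreover have "\<bar>c z * k z\<bar> \<le> \<bar>C * k z\<bar>" for z
    using assms(3)[of z] by (simp add: abs_mult mult_right_mono)
  ultimately show ?thesis
    using assms(1,2) by (intro Bochner_Integration.integrable_bound[OF \<open>integrable M (\<lambda>z. C * k z)\<close>]) auto
qed

text \<open>The sublevel sets \<open>L n\<close> of the functional at height \<open>inf + 1/(n+1)\<close> decrease, so the infima
  \<open>q n\<close> of \<open>Q\<close> over them increase to a finite limit. For near minimizers \<open>k n \<in> L n\<close> the midpoint
  of \<open>k n\<close> and \<open>k p\<close> with \<open>n \<le> p\<close> is still in \<open>L n\<close>; the parallelogram law then bounds the
  weighted \<open>L\<^sup>2\<close> distance by the gap \<open>q p - q n\<close>, up to an error of order \<open>1/n\<close>. Membership in \<open>K\<close> forces \<open>k = 0\<close> where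
  \<open>H = 0\<close>, so that the convention \<open>0 / 0 = 0\<close> gives the right weight there.\<close>

lemma minimum_attained_on_AE_closed_midpoint_convex_set:
  fixes M :: "'a measure" and H c :: "'a \<Rightarrow> real" and K :: "('a \<Rightarrow> real) set"
  assumes H: "integrable M H"
    and c: "c \<in> borel_measurable M" and c_bound: "\<And>z. \<bar>c z\<bar> \<le> C"
    and K_meas: "\<And>k. k \<in> K \<Longrightarrow> k \<in> borel_measurable M"
    and K_bounds: "\<And>k. k \<in> K \<Longrightarrow> AE z in M. 0 \<le> k z \<and> k z \<le> H z"
    and K_midpoint: "\<And>k l. k \<in> K \<Longrightarrow> l \<in> K \<Longrightarrow> (\<lambda>z. (k z + l z) / 2) \<in> K"
    and K_closed: "\<And>k l. (\<And>n. k n \<in> K) \<Longrightarrow> l \<in> borel_measurable M \<Longrightarrow>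
                     (AE z in M. (\<lambda>n. k n z) \<longlonglongrightarrow> l z) \<Longrightarrow> l \<in> K"
    and K_nonempty: "K \<noteq> {}"
  shows "\<exists>h\<in>K. \<forall>k\<in>K. (LINT z|M. c z * h z) \<le> (LINT z|M. c z * k z)"
proof -
  define J where "J k = (LINT z|M. c z * k z)" for k
  define Q where "Q k = (LINT z|M. (k z)\<^sup>2 / H z)" for k
  have H_meas [measurable]: "H \<in> borel_measurable M" and c_meas [measurable]: "c \<in> borel_measurable M"
    using H c by auto
  note K_meas [measurable]
  have C0: "0 \<le> C" using c_bound[of undefined] by linarith
  have cH: "integrable M (\<lambda>z. C * H z)" using H by simp
  have int_k: "integrable M k" if "k \<in> K" for k
    using K_bounds[OF that] that by (intro Bochner_Integration.integrable_bound[OF H]) auto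
  have ck_le: "AE z in M. norm (c z * k z) \<le> C * H z" if "k \<in> K" for k
    using K_bounds[OF that] by eventually_elim (auto simp: abs_mult intro!: mult_mono c_bound C0)
  have int_ck: "integrable M (\<lambda>z. c z * k z)" if "k \<in> K" for k
    by (rule integrable_bounded_mult[OF int_k[OF that] c c_bound])
  have q_le: "AE z in M. 0 \<le> (k z)\<^sup>2 / H z \<and> (k z)\<^sup>2 / H z \<le> H z" if "k \<in> K" for k
    using K_bounds[OF that]
  proof eventually_elim
    case (elim z)
    then have "(k z)\<^sup>2 \<le> H z * H z" by (auto simp: power2_eq_square intro!: mult_mono)
    then show ?case using elim by (cases "H z = 0") (auto simp: divide_simps)
  qed
  have int_q: "integrable M (\<lambda>z. (k z)\<^sup>2 / H z)" if "k \<in> K" for k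
  proof (rule Bochner_Integration.integrable_bound[OF H])
    show "(\<lambda>z. (k z)\<^sup>2 / H z) \<in> borel_measurable M" using that by measurable
    show "AE z in M. norm ((k z)\<^sup>2 / H z) \<le> norm (H z)"
      using q_le[OF that] by eventually_elim simp
  qed
  have J_mid: "J (\<lambda>z. (k z + l z) / 2) = (J k + J l) / 2" if "k \<in> K" "l \<in> K" for k l
  proof -
    have "J (\<lambda>z. (k z + l z) / 2) = (LINT z|M. (c z * k z + c z * l z) / 2)"
      unfolding J_def by (intro Bochner_Integration.integral_cong) (auto simp: algebra_simps)
    then show ?thesis using int_ck[OF that(1)] int_ck[OF that(2)] by (simp add: J_def)
  qed
  define m where "m = (INF k\<in>K. J k)"
  have J_ge: "- (LINT z|M. C * H z) \<le> J k" if "k \<in> K" for k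
  proof -
    have "norm (J k) \<le> (LINT z|M. norm (c z * k z))"
      unfolding J_def by (rule integral_norm_bound)
    also have "\<dots> \<le> (LINT z|M. C * H z)"
      by (intro integral_mono_AE integrable_norm int_ck that cH ck_le)
    finally have "norm (J k) \<le> (LINT z|M. C * H z)" .
    then show ?thesis by auto
  qed
  have J_bdd: "bdd_below (J ` K)" by (rule bdd_belowI2[OF J_ge])
  have m_le: "m \<le> J k" if "k \<in> K" for k
    unfolding m_def by (rule cINF_lower[OF J_bdd that])
  define L where "L n = {k\<in>K. J k \<le> m + 1 / real (Suc n)}" for n
  have L_nonempty: "L n \<noteq> {}" for n
  proof -
    have "(INF k\<in>K. J k) < m + 1 / real (Suc n)" by (simp add: m_def)
    then obtain k where "k \<in> K" "J k < m + 1 / real (Suc n)"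
      by (subst (asm) cINF_less_iff[OF K_nonempty J_bdd]) blast
    then show ?thesis by (auto simp: L_def less_imp_le)
  qed
  have L_K: "L n \<subseteq> K" for n by (auto simp: L_def)
  have L_mono: "L p \<subseteq> L n" if "n \<le> p" for n p
  proof -
    have "1 / real (Suc p) \<le> 1 / real (Suc n)" using that by (simp add: frac_le)
    then show ?thesis by (auto simp: L_def)
  qed
  define q where "q n = (INF k\<in>L n. Q k)" for n
  have Q_nonneg: "0 \<le> Q k" if "k \<in> K" for k
    unfolding Q_def using q_le[OF that] by (intro integral_nonneg_AE) auto
  have Q_le: "Q k \<le> (LINT z|M. H z)" if "k \<in> K" for k
    unfolding Q_def using q_le[OF that] by (intro integral_mono_AE int_q that H) auto
  have Q_bdd: "bdd_below (Q ` L n)" for n using L_K by (intro bdd_belowI2[OF Q_nonneg]) auto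
  have q_le_Q: "q n \<le> Q k" if "k \<in> L n" for n k
    unfolding q_def by (rule cINF_lower[OF Q_bdd that])
  have "\<exists>k\<in>L n. Q k < q n + 1 / real (Suc n)" for n
  proof -
    have "(INF k\<in>L n. Q k) < q n + 1 / real (Suc n)" by (simp add: q_def)
    then show ?thesis
      by (subst (asm) cINF_less_iff[OF L_nonempty Q_bdd])
  qed
  then obtain k where k_L: "\<And>n. k n \<in> L n" and k_Q: "\<And>n. Q (k n) < q n + 1 / real (Suc n)"
    by metis
  have k_K: "k n \<in> K" for n using k_L L_K by auto
  have q_mono: "q n \<le> q p" if "n \<le> p" for n p
    unfolding q_def by (rule cINF_superset_mono[OF L_nonempty Q_bdd L_mono[OF that] order_refl])
  have q_bound: "q n \<le> (LINT z|M. H z)" for n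
    using q_le_Q[OF k_L[of n]] Q_le[OF k_K[of n]] by linarith
  have "Cauchy q"
  proof (rule LIMSEQ_imp_Cauchy[OF LIMSEQ_incseq_SUP])
    show "incseq q" using q_mono by (auto simp: incseq_def)
    show "bdd_above (range q)" by (rule bdd_aboveI2[OF q_bound])
  qed
  \<comment> \<open>Stated for arbitrary functions, to keep the simplifier from merging factors with the
    quotients by \<open>H\<close>.\<close>
  have lin: "(LINT z|M. 2 * u z + 2 * v z - 4 * w z)
       = 2 * integral\<^sup>L M u + 2 * integral\<^sup>L M v - 4 * integral\<^sup>L M w"
    if "integrable M u" "integrable M v" "integrable M w" for u v w :: "'a \<Rightarrow> real"
    using that by simp
  define D where "D n p = (LINT z|M. (k n z - k p z)\<^sup>2 / H z)" for n p
  have int_d: "integrable M (\<lambda>z. (k n z - k p z)\<^sup>2 / H z)"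
    and D_parallelogram: "D n p = 2 * Q (k n) + 2 * Q (k p) - 4 * Q (\<lambda>z. (k n z + k p z) / 2)" for n p
  proof -
    have mid: "(\<lambda>z. (k n z + k p z) / 2) \<in> K" by (intro K_midpoint k_K)
    have eq: "(k n z - k p z)\<^sup>2 / H z
         = 2 * ((k n z)\<^sup>2 / H z) + 2 * ((k p z)\<^sup>2 / H z) - 4 * (((k n z + k p z) / 2)\<^sup>2 / H z)" for z
      by (cases "H z = 0") (auto simp: field_simps power2_eq_square)
    show "integrable M (\<lambda>z. (k n z - k p z)\<^sup>2 / H z)"
      unfolding eq using int_q[OF mid] int_q[OF k_K[of n]] int_q[OF k_K[of p]]
      by (intro Bochner_Integration.integrable_diff Bochner_Integration.integrable_add integrable_mult_right)
    show "D n p = 2 * Q (k n) + 2 * Q (k p) - 4 * Q (\<lambda>z. (k n z + k p z) / 2)"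
      unfolding D_def eq Q_def
      by (rule lin[OF int_q[OF k_K] int_q[OF k_K] int_q[OF mid]])
  qed
  have D_small: "D n p \<le> 2 * (q p - q n) + 4 / real (Suc n)" if "n \<le> p" for n p
  proof -
    let ?mid = "\<lambda>z. (k n z + k p z) / 2"
    have "k p \<in> L n" using k_L L_mono[OF that] by auto
    then have "J ?mid \<le> m + 1 / real (Suc n)"
      using k_L[of n] by (auto simp: J_mid[OF k_K k_K] L_def)
    then have "?mid \<in> L n" using K_midpoint[OF k_K k_K] by (auto simp: L_def)
    then have "q n \<le> Q ?mid" by (rule q_le_Q)
    moreover have "1 / real (Suc p) \<le> 1 / real (Suc n)" using that by (simp add: frac_le)
    ultimately show ?thesis using k_Q[of n] k_Q[of p] by (simp add: D_parallelogram)
  qed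
  have D_Cauchy: "\<exists>N. \<forall>n\<ge>N. \<forall>p\<ge>N. D n p < e" if "e > 0" for e
  proof -
    have "\<exists>N. \<forall>n\<ge>N. \<forall>p\<ge>N. norm (q n - q p) < e / 4"
      using that by (intro CauchyD[OF \<open>Cauchy q\<close>]) simp
    then obtain N1 where N1: "\<And>n p. n \<ge> N1 \<Longrightarrow> p \<ge> N1 \<Longrightarrow> \<bar>q n - q p\<bar> < e / 4"
      by auto
    obtain N2 where N2: "4 / real (Suc N2) < e / 2"
      using reals_Archimedean[of "e / 8"] \<open>e > 0\<close> by (auto simp: field_simps)
    have *: "D n p < e" if "n \<ge> max N1 N2" "n \<le> p" for n p
    proof -
      have "4 / real (Suc n) \<le> 4 / real (Suc N2)" using that by (simp add: frac_le)
      moreover have "\<bar>q n - q p\<bar> < e / 4" using that by (intro N1) auto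
      moreover have "D n p \<le> 2 * (q p - q n) + 4 / real (Suc n)" using that by (intro D_small) auto
      ultimately show ?thesis using N2 by argo
    qed
    have "D n p = D p n" for n p by (simp add: D_def power2_commute)
    then show ?thesis using * by (metis linear)
  qed
  \<comment> \<open>Young's inequality \<open>\<bar>u\<bar> \<le> u\<^sup>2 / (2 e H) + e H / 2\<close> turns the weighted \<open>L\<^sup>2\<close> bound
    into an \<open>L\<^sup>1\<close> bound.\<close>
  have L1_le: "(LINT z|M. norm (k n z - k p z)) \<le> D n p / (2 * e) + e / 2 * (LINT z|M. H z)"
    if "e > 0" for e n p
  proof -
    have "(LINT z|M. norm (k n z - k p z))
          \<le> (LINT z|M. (k n z - k p z)\<^sup>2 / H z / (2 * e) + e / 2 * H z)"
    proof (intro integral_mono_AE)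
      show "integrable M (\<lambda>z. norm (k n z - k p z))"
        using int_k[OF k_K[of n]] int_k[OF k_K[of p]] by auto
      show "integrable M (\<lambda>z. (k n z - k p z)\<^sup>2 / H z / (2 * e) + e / 2 * H z)"
        using int_d H by (intro Bochner_Integration.integrable_add integrable_mult_right integrable_divide) auto
      show "AE z in M. norm (k n z - k p z) \<le> (k n z - k p z)\<^sup>2 / H z / (2 * e) + e / 2 * H z"
        using K_bounds[OF k_K[of n]] K_bounds[OF k_K[of p]]
      proof eventually_elim
        case (elim z)
        show ?case
        proof (cases "H z = 0")
          case False
          then have "H z > 0" using elim by auto
          moreover have "0 \<le> (\<bar>k n z - k p z\<bar> - e * H z)\<^sup>2" by simp
          ultimately show ?thesis using that
            by (simp add: field_simps power2_eq_square abs_mult_self_eq) 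
        qed (use elim in auto)
      qed
    qed
    also have "\<dots> = D n p / (2 * e) + e / 2 * (LINT z|M. H z)"
      unfolding D_def using int_d[of n p] H
      by (subst Bochner_Integration.integral_add) (auto simp only: integral_mult_right_zero integral_divide_zero
            intro!: integrable_divide integrable_mult_right)
    finally show ?thesis .
  qed
  have "\<exists>N. \<forall>i\<ge>N. \<forall>j\<ge>N. (LINT z|M. norm (k i z - k j z)) < e" if "e > 0" for e
  proof -
    define S where "S = (LINT z|M. H z)"
    have "0 \<le> S" using Q_nonneg[OF k_K[of 0]] Q_le[OF k_K[of 0]] by (simp add: S_def)
    \<comment> \<open>With the parameter \<open>d\<close>, the two terms of \<open>L1_le\<close> are each below \<open>e / 2\<close>; the summand
      \<open>1\<close> covers the case \<open>S = 0\<close>.\<close>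
    define d where "d = e / (S + 1)"
    have "d > 0" using that \<open>0 \<le> S\<close> by (simp add: d_def)
    have "d * S < e" using that \<open>0 \<le> S\<close> by (simp add: d_def field_simps)
    obtain N where N: "\<And>n p. n \<ge> N \<Longrightarrow> p \<ge> N \<Longrightarrow> D n p < d * e"
      using D_Cauchy[of "d * e"] \<open>d > 0\<close> \<open>e > 0\<close> by auto
    have "(LINT z|M. norm (k i z - k j z)) < e" if "i \<ge> N" "j \<ge> N" for i j
    proof -
      have "D i j / (2 * d) < e / 2"
        using N[OF that] \<open>d > 0\<close> by (simp add: field_simps)
      then show ?thesis
        using L1_le[OF \<open>d > 0\<close>, of i j] \<open>d * S < e\<close> unfolding S_def[symmetric] by linarith
    qed
    then show ?thesis by blast
  qed
  then obtain r where r: "strict_mono r" and r_AE: "AE z in M. Cauchy (\<lambda>i. k (r i) z)"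
    using cauchy_L1_AE_cauchy_subseq[of M k] int_k k_K by blast
  define h where "h z = lim (\<lambda>i. k (r i) z)" for z
  have [measurable]: "h \<in> borel_measurable M"
    unfolding h_def using K_meas[OF k_K] by (intro borel_measurable_lim_metric) auto
  have lim: "AE z in M. (\<lambda>i. k (r i) z) \<longlonglongrightarrow> h z"
    using r_AE by eventually_elim (auto simp: h_def Cauchy_convergent_iff convergent_LIMSEQ_iff)
  have h_K: "h \<in> K" by (rule K_closed[OF _ _ lim]) (auto simp: k_K)
  have "(\<lambda>i. J (k (r i))) \<longlonglongrightarrow> J h"
    unfolding J_def
  proof (rule integral_dominated_convergence[OF _ _ cH])
    show "AE z in M. (\<lambda>i. c z * k (r i) z) \<longlonglongrightarrow> c z * h z"
      using lim by eventually_elim (intro tendsto_intros)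
    show "AE z in M. norm (c z * k (r i) z) \<le> C * H z" for i by (rule ck_le[OF k_K])
    show "(\<lambda>z. c z * k (r i) z) \<in> borel_measurable M" for i using K_meas[OF k_K] by measurable
  qed auto
  moreover have "(\<lambda>i. m + 1 / real (Suc (r i))) \<longlonglongrightarrow> m + 0"
    using LIMSEQ_subseq_LIMSEQ[OF LIMSEQ_inverse_real_of_nat r]
    by (intro tendsto_add tendsto_const) (simp add: o_def inverse_eq_divide)
  ultimately have "J h \<le> m + 0"
    by (rule LIMSEQ_le) (use k_L in \<open>auto simp: L_def\<close>)
  then show ?thesis using h_K m_le unfolding J_def by force
qed



section \<open>Closure properties of the set of transport plans\<close>

text \<open>Lebesgue measure on a product is the completion of the product of the Borel--Lebesgue
  measures, not itself a product measure, so Fubini is applied to a Borel null set that contains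
  the exceptional set. The same detour, through a Borel representative, serves the next lemma.\<close>

lemma AE_lebesgue_prod_sections:
  fixes P :: "'a::euclidean_space \<times> 'b::euclidean_space \<Rightarrow> bool"
  assumes "AE z in lebesgue. P z"
  shows "AE x in lebesgue. AE y in lebesgue. P (x, y)"
    and "AE y in lebesgue. AE x in lebesgue. P (x, y)"
proof -
  have P: "AE z in lborel \<Otimes>\<^sub>M lborel. P z"
    using assms unfolding lborel_prod by (simp add: AE_completion_iff)
  then show "AE x in lebesgue. AE y in lebesgue. P (x, y)"
    using lborel_pair.AE_pair[OF P] by (simp add: AE_completion_iff)
  obtain N where "N \<in> null_sets (lborel \<Otimes>\<^sub>M lborel)"
    and N: "{z \<in> space (lborel \<Otimes>\<^sub>M lborel). \<not> P z} \<subseteq> N"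
    using P by (auto simp: eventually_ae_filter)
  then have N_sets [measurable]: "N \<in> sets (lborel \<Otimes>\<^sub>M lborel)"
    and N_AE: "AE z in lborel \<Otimes>\<^sub>M lborel. z \<notin> N"
    by (auto dest: AE_not_in)
  have "AE y in lborel. AE x in lborel. (x, y) \<notin> N"
    using lborel_pair.AE_pair[OF N_AE]
    by (subst (asm) lborel_pair.AE_commute) measurable
  then have "AE y in lborel. AE x in lborel. P (x, y)"
  proof eventually_elim
    case (elim y)
    then show ?case by eventually_elim (use N in \<open>auto simp: space_pair_measure\<close>)
  qed
  then show "AE y in lebesgue. AE x in lebesgue. P (x, y)"
    by (simp add: AE_completion_iff)
qed

lemma integrable_lebesgue_prod_sections:
  fixes h :: "'a::euclidean_space \<times> 'b::euclidean_space \<Rightarrow> real"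
  assumes "integrable lebesgue h"
  shows "AE x in lebesgue. integrable lebesgue (\<lambda>y. h (x, y))"
    and "AE y in lebesgue. integrable lebesgue (\<lambda>x. h (x, y))"
proof -
  have "h \<in> borel_measurable lebesgue" using assms by auto
  then obtain h' where h' [measurable]: "h' \<in> borel_measurable lborel"
    and eq: "AE z in lborel. h z = h' z"
    using completion_ex_borel_measurable_real by blast
  have "integrable lebesgue h'"
    using assms eq h' by (subst integrable_cong_AE[of _ _ h]) (auto simp: AE_completion_iff measurable_completion)
  then have int: "integrable (lborel \<Otimes>\<^sub>M lborel) h'"
    using h' by (simp add: integrable_completion lborel_prod)
  have transfer: "integrable lebesgue u"
    if "AE y in lebesgue. u y = v y" "integrable lborel v" for u v :: "'c::euclidean_space \<Rightarrow> real"
  proof -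
    have "integrable lebesgue v" using that(2) by (simp add: integrable_completion)
    moreover have "AE y in lebesgue. v y = u y" using that(1) by eventually_elim simp
    then have "u \<in> borel_measurable lebesgue"
      by (rule borel_measurable_AE[OF borel_measurable_integrable[OF \<open>integrable lebesgue v\<close>]])
    ultimately show ?thesis using that(1) by (subst integrable_cong_AE[of _ _ v]) auto
  qed
  have eq': "AE z in lebesgue. h z = h' z" using eq by (simp add: AE_completion_iff)
  show "AE x in lebesgue. integrable lebesgue (\<lambda>y. h (x, y))"
    using AE_lebesgue_prod_sections(1)[OF eq'] AE_completion[OF lborel_pair.AE_integrable_fst'[OF int]]
  proof eventually_elim
    case (elim x)
    show ?case by (rule transfer[OF elim])
  qed
  have int2: "integrable (lborel \<Otimes>\<^sub>M lborel) (\<lambda>(y, x). h' (x, y))"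
    by (rule lborel_pair.integrable_product_swap[OF int])
  show "AE y in lebesgue. integrable lebesgue (\<lambda>x. h (x, y))"
    using AE_lebesgue_prod_sections(2)[OF eq'] AE_completion[OF lborel_pair.AE_integrable_fst'[OF int2]]
  proof eventually_elim
    case (elim y)
    show ?case by (rule transfer[OF elim(1)]) (use elim(2) in simp)
  qed
qed

lemma has_bochner_integral_dominated_AE_limit:
  fixes u :: "nat \<Rightarrow> 'a \<Rightarrow> real"
  assumes u: "\<And>n. has_bochner_integral M (u n) a"
    and v: "v \<in> borel_measurable M" and w: "integrable M w"
    and lim: "AE y in M. (\<lambda>n. u n y) \<longlonglongrightarrow> v y"
    and bound: "AE y in M. \<forall>n. \<bar>u n y\<bar> \<le> w y"
  shows "has_bochner_integral M v a"
proof -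
  have meas: "u n \<in> borel_measurable M" and int: "integral\<^sup>L M (u n) = a" for n
    using u[of n] by (auto simp: has_bochner_integral_iff)
  have bound': "AE y in M. norm (u n y) \<le> w y" for n
    using bound by eventually_elim simp
  have "integrable M v"
    by (rule integrable_dominated_convergence[OF v meas w lim bound'])
  moreover have "(\<lambda>n. integral\<^sup>L M (u n)) \<longlonglongrightarrow> integral\<^sup>L M v"
    by (rule integral_dominated_convergence[OF v meas w lim bound'])
  then have "integral\<^sup>L M v = a"
    by (auto simp: int LIMSEQ_const_iff)
  ultimately show ?thesis by (simp add: has_bochner_integral_iff)
qed

text \<open>For almost every \<open>x\<close> the sections \<open>k n (x, \<cdot>)\<close> converge almost everywhere under the
  integrable bound \<open>hbar (x, \<cdot>)\<close>, and their integrals are all \<open>f x\<close>.\<close>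

lemma transport_plans_AE_closed:
  assumes hbar: "nonneg_L1 hbar"
    and k: "\<And>n::nat. k n \<in> transport_plans f g hbar"
    and h: "h \<in> borel_measurable lebesgue"
    and lim: "AE z in lebesgue. (\<lambda>n. k n z) \<longlonglongrightarrow> h z"
  shows "h \<in> transport_plans f g hbar"
proof -
  have int_hbar: "integrable lebesgue hbar" using hbar by (simp add: nonneg_L1_def)
  have "AE z in lebesgue. 0 \<le> k n z" "AE z in lebesgue. k n z \<le> hbar z" for n
    using k[of n] by (auto simp: transport_plans_def nonneg_L1_def)
  then have "AE z in lebesgue. 0 \<le> k n z \<and> k n z \<le> hbar z" for n
    by eventually_elim simp
  then have k_bounds: "AE z in lebesgue. \<forall>n. 0 \<le> k n z \<and> k n z \<le> hbar z"
    by (simp add: AE_all_countable)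
  then have k_abs: "AE z in lebesgue. \<forall>n. \<bar>k n z\<bar> \<le> hbar z"
    by eventually_elim (auto simp: abs_of_nonneg)
  have h_bounds: "AE z in lebesgue. 0 \<le> h z \<and> h z \<le> hbar z"
    using k_bounds lim
  proof eventually_elim
    case (elim z)
    have "0 \<le> h z" by (rule LIMSEQ_le_const[OF elim(2)]) (use elim(1) in auto)
    moreover have "h z \<le> hbar z"
      by (rule LIMSEQ_le_const2[OF elim(2)]) (use elim(1) in auto)
    ultimately show ?case by simp
  qed
  have int_h: "integrable lebesgue h"
    by (rule Bochner_Integration.integrable_bound[OF int_hbar h], use h_bounds in eventually_elim) auto
  have "AE x in lebesgue. \<forall>n. has_bochner_integral lebesgue (\<lambda>y. k n (x, y)) (f x)"
    and "AE y in lebesgue. \<forall>n. has_bochner_integral lebesgue (\<lambda>x. k n (x, y)) (g y)"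
    using k by (auto simp: transport_plans_def AE_all_countable)
  note k_marg = this
  have "AE x in lebesgue. has_bochner_integral lebesgue (\<lambda>y. h (x, y)) (f x)"
    using k_marg(1) integrable_lebesgue_prod_sections(1)[OF int_h]
      integrable_lebesgue_prod_sections(1)[OF int_hbar]
      AE_lebesgue_prod_sections(1)[OF lim] AE_lebesgue_prod_sections(1)[OF k_abs]
  proof eventually_elim
    case (elim x)
    show ?case
      by (rule has_bochner_integral_dominated_AE_limit[OF _ _ elim(3) elim(4) elim(5)])
        (use elim(1,2) in auto)
  qed
  moreover have "AE y in lebesgue. has_bochner_integral lebesgue (\<lambda>x. h (x, y)) (g y)"
    using k_marg(2) integrable_lebesgue_prod_sections(2)[OF int_h]
      integrable_lebesgue_prod_sections(2)[OF int_hbar]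
      AE_lebesgue_prod_sections(2)[OF lim] AE_lebesgue_prod_sections(2)[OF k_abs]
  proof eventually_elim
    case (elim y)
    show ?case
      by (rule has_bochner_integral_dominated_AE_limit[OF _ _ elim(3) elim(4) elim(5)])
        (use elim(1,2) in auto)
  qed
  ultimately show ?thesis
    using int_h h_bounds by (auto simp: transport_plans_def nonneg_L1_def)
qed

lemma transport_plans_midpoint:
  assumes k: "k \<in> transport_plans f g hbar" and l: "l \<in> transport_plans f g hbar"
  shows "(\<lambda>z. (k z + l z) / 2) \<in> transport_plans f g hbar"
proof -
  have mid: "has_bochner_integral M (\<lambda>y. (u y + v y) / 2) a"
    if "has_bochner_integral M u a" "has_bochner_integral M v a" for M and u v :: "'b \<Rightarrow> real" and a
    using has_bochner_integral_divide_zero[OF has_bochner_integral_add[OF that], of 2] by simp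
  have "AE x in lebesgue. has_bochner_integral lebesgue (\<lambda>y. k (x, y)) (f x)"
    "AE x in lebesgue. has_bochner_integral lebesgue (\<lambda>y. l (x, y)) (f x)"
    using k l by (auto simp: transport_plans_def)
  then have 1: "AE x in lebesgue. has_bochner_integral lebesgue (\<lambda>y. (k (x, y) + l (x, y)) / 2) (f x)"
    by eventually_elim (rule mid)
  have "AE y in lebesgue. has_bochner_integral lebesgue (\<lambda>x. k (x, y)) (g y)"
    "AE y in lebesgue. has_bochner_integral lebesgue (\<lambda>x. l (x, y)) (g y)"
    using k l by (auto simp: transport_plans_def)
  then have 2: "AE y in lebesgue. has_bochner_integral lebesgue (\<lambda>x. (k (x, y) + l (x, y)) / 2) (g y)"
    by eventually_elim (rule mid)
  have "AE z in lebesgue. 0 \<le> k z" "AE z in lebesgue. 0 \<le> l z"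
    "AE z in lebesgue. k z \<le> hbar z" "AE z in lebesgue. l z \<le> hbar z"
    using k l by (auto simp: transport_plans_def nonneg_L1_def)
  then have "AE z in lebesgue. 0 \<le> (k z + l z) / 2 \<and> (k z + l z) / 2 \<le> hbar z"
    by eventually_elim auto
  moreover have "integrable lebesgue k" "integrable lebesgue l"
    using k l by (auto simp: transport_plans_def nonneg_L1_def)
  ultimately show ?thesis
    using 1 2 by (auto simp: transport_plans_def nonneg_L1_def)
qed



section \<open>The sign of second differences\<close>

lemma has_field_derivative_along_line:
  fixes u :: "'a::real_normed_vector \<Rightarrow> real"
  assumes "(u has_derivative u') (at (w + \<tau> *\<^sub>R v))"
  shows "((\<lambda>\<tau>. u (w + \<tau> *\<^sub>R v)) has_field_derivative u' v) (at \<tau>)"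
proof -
  have line: "((\<lambda>\<tau>. w + \<tau> *\<^sub>R v) has_derivative (\<lambda>h. h *\<^sub>R v)) (at \<tau>)"
    by (auto intro!: derivative_eq_intros)
  have "u' (h *\<^sub>R v) = u' v * h" for h
    using linear_scale[OF has_derivative_linear[OF assms]] by (simp add: mult.commute)
  then show ?thesis
    using has_derivative_compose[OF line assms] by (simp add: has_field_derivative_def fun_eq_iff mult_commute_abs)
qed

lemma blinfun_has_derivative_eval:
  assumes "(c' has_derivative blinfun_apply c'') (at z)"
  shows "((\<lambda>z. blinfun_apply (c' z) b) has_derivative (\<lambda>a. blinfun_apply (blinfun_apply c'' a) b)) (at z)"
  using assms by (auto intro!: derivative_eq_intros)

lemma mixed_partials_eq_second_derivative:
  fixes c :: "(real^'d) \<times> (real^'d) \<Rightarrow> real"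
  assumes U: "open U" "(x, y) \<in> U"
    and c': "\<And>z. z \<in> U \<Longrightarrow> (c has_derivative blinfun_apply (c' z)) (at z)"
    and c'': "\<And>z. z \<in> U \<Longrightarrow> (c' has_derivative blinfun_apply (c'' z)) (at z)"
  shows "mixed_partials c x y $ i $ j
         = blinfun_apply (blinfun_apply (c'' (x, y)) (axis i 1, 0)) (0, axis j 1)"
proof -
  let ?a = "(axis i 1, 0) :: (real^'d) \<times> (real^'d)" and ?b = "(0, axis j 1) :: (real^'d) \<times> (real^'d)"
  have inner: "deriv (\<lambda>t. c (x + s *\<^sub>R axis i 1, y + t *\<^sub>R axis j 1)) 0 = c' ((x, y) + s *\<^sub>R ?a) ?b"
    if "(x, y) + s *\<^sub>R ?a \<in> U" for s
  proof -
    have "((\<lambda>t. c ((x, y) + s *\<^sub>R ?a + t *\<^sub>R ?b)) has_field_derivative c' ((x, y) + s *\<^sub>R ?a) ?b) (at 0)"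
      by (rule has_field_derivative_along_line) (use c'[OF that] in simp)
    then show ?thesis by (intro DERIV_imp_deriv) simp
  qed
  have "((\<lambda>s. (x, y) + s *\<^sub>R ?a) \<longlongrightarrow> (x, y) + 0 *\<^sub>R ?a) (nhds 0)"
    by (intro tendsto_intros) (auto simp: filterlim_ident)
  then have "eventually (\<lambda>s. (x, y) + s *\<^sub>R ?a \<in> U) (nhds 0)"
    by (rule topological_tendstoD) (use U in auto)
  then have ev: "eventually (\<lambda>s. deriv (\<lambda>t. c (x + s *\<^sub>R axis i 1, y + t *\<^sub>R axis j 1)) 0
                     = c' ((x, y) + s *\<^sub>R ?a) ?b) (nhds 0)"
    by eventually_elim (rule inner)
  have "((\<lambda>s. c' ((x, y) + s *\<^sub>R ?a) ?b) has_field_derivative c'' (x, y) ?a ?b) (at 0)"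
    by (rule has_field_derivative_along_line) (use c''[OF U(2)] in \<open>simp add: blinfun_has_derivative_eval\<close>)
  then show ?thesis
    by (simp add: mixed_partials_def deriv_cong_ev[OF ev refl] DERIV_imp_deriv)
qed

text \<open>By the mean value theorem, used once in each direction, the second difference equals
  \<open>s * t\<close> times the mixed second derivative at some point of the parallelogram spanned by
  \<open>s *\<^sub>R a\<close> and \<open>t *\<^sub>R b\<close>. The parallelogram lies in the ball because the ball is convex, and on a
  small ball the derivative keeps the sign of its value \<open>m\<close> at the centre.\<close>

lemma second_difference_sign:
  fixes c :: "'a::real_normed_vector \<Rightarrow> real"
  assumes U: "open U" "z0 \<in> U"
    and c': "\<And>z. z \<in> U \<Longrightarrow> (c has_derivative blinfun_apply (c' z)) (at z)"
    and c'': "\<And>z. z \<in> U \<Longrightarrow> (c' has_derivative blinfun_apply (c'' z)) (at z)"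
    and cont: "continuous_on U c''"
    and nz: "blinfun_apply (blinfun_apply (c'' z0) a) b = m" "m \<noteq> 0"
  obtains r where "r > 0" "ball z0 r \<subseteq> U"
    "\<And>z s t. \<lbrakk>s > 0; t > 0; {z, z + s *\<^sub>R a, z + t *\<^sub>R b, z + s *\<^sub>R a + t *\<^sub>R b} \<subseteq> ball z0 r\<rbrakk> \<Longrightarrow>
       0 < m * (c (z + s *\<^sub>R a + t *\<^sub>R b) - c (z + t *\<^sub>R b) - (c (z + s *\<^sub>R a) - c z))"
proof -
  have "continuous_on U (\<lambda>z. m * c'' z a b)" using cont by (intro continuous_intros)
  then have "open {z \<in> U. m * c'' z a b \<in> {0<..}}"
    using continuous_open_preimage[OF _ U(1) open_greaterThan] by (simp add: vimage_def Int_def)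
  moreover have "z0 \<in> {z \<in> U. m * c'' z a b \<in> {0<..}}"
    using U nz by (auto simp: zero_less_mult_iff) 
  ultimately obtain r where r: "r > 0" "ball z0 r \<subseteq> {z \<in> U. m * c'' z a b \<in> {0<..}}"
    using open_contains_ball by blast
  then have ball_U: "z \<in> ball z0 r \<Longrightarrow> z \<in> U" and pos: "z \<in> ball z0 r \<Longrightarrow> 0 < m * c'' z a b" for z
    by auto
  have between: "w + \<sigma> *\<^sub>R v \<in> ball z0 r"
    if "w \<in> ball z0 r" "w + s *\<^sub>R v \<in> ball z0 r" "0 \<le> \<sigma>" "\<sigma> \<le> s" "0 < s" for w v \<sigma> s
  proof -
    have "(1 - \<sigma> / s) *\<^sub>R w + (\<sigma> / s) *\<^sub>R (w + s *\<^sub>R v) \<in> ball z0 r"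
      using that by (intro convexD_alt[OF convex_ball]) auto
    then show ?thesis using that by (simp add: algebra_simps)
  qed
  show ?thesis
  proof
    show "ball z0 r \<subseteq> U" using ball_U by blast
    fix z s t
    assume s: "s > (0::real)" and t: "t > (0::real)"
      and corners: "{z, z + s *\<^sub>R a, z + t *\<^sub>R b, z + s *\<^sub>R a + t *\<^sub>R b} \<subseteq> ball z0 r"
    define \<phi> where "\<phi> \<tau> = c (z + s *\<^sub>R a + \<tau> *\<^sub>R b) - c (z + \<tau> *\<^sub>R b)" for \<tau>
    have left: "z + \<tau> *\<^sub>R b \<in> ball z0 r" and right: "z + s *\<^sub>R a + \<tau> *\<^sub>R b \<in> ball z0 r"
      if "0 \<le> \<tau>" "\<tau> \<le> t" for \<tau>
      using corners by (auto intro!: between[OF _ _ that t] simp del: mem_ball)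
    have "(\<phi> has_field_derivative (c' (z + s *\<^sub>R a + \<tau> *\<^sub>R b) b - c' (z + \<tau> *\<^sub>R b) b)) (at \<tau>)"
      if "0 \<le> \<tau>" "\<tau> \<le> t" for \<tau>
      unfolding \<phi>_def
      by (rule DERIV_diff[OF has_field_derivative_along_line[OF c'[OF ball_U[OF right[OF that]]]]
            has_field_derivative_along_line[OF c'[OF ball_U[OF left[OF that]]]]])
    from MVT2[OF t this] obtain \<tau> where \<tau>: "0 < \<tau>" "\<tau> < t"
      and \<phi>_eq: "\<phi> t - \<phi> 0 = (t - 0) * (c' (z + s *\<^sub>R a + \<tau> *\<^sub>R b) b - c' (z + \<tau> *\<^sub>R b) b)"
      by blast
    define \<psi> where "\<psi> \<sigma> = c' (z + \<tau> *\<^sub>R b + \<sigma> *\<^sub>R a) b" for \<sigma>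
    have inside: "z + \<tau> *\<^sub>R b + \<sigma> *\<^sub>R a \<in> ball z0 r" if "0 \<le> \<sigma>" "\<sigma> \<le> s" for \<sigma>
    proof (rule between[OF _ _ that s])
      show "z + \<tau> *\<^sub>R b \<in> ball z0 r" using left \<tau> by simp
      show "z + \<tau> *\<^sub>R b + s *\<^sub>R a \<in> ball z0 r"
        using right[of \<tau>] \<tau> by (simp add: add.assoc add.commute[of "s *\<^sub>R a"] del: mem_ball)
    qed
    have "(\<psi> has_field_derivative c'' (z + \<tau> *\<^sub>R b + \<sigma> *\<^sub>R a) a b) (at \<sigma>)"
      if "0 \<le> \<sigma>" "\<sigma> \<le> s" for \<sigma>
      unfolding \<psi>_def
      by (rule has_field_derivative_along_line[OF
            blinfun_has_derivative_eval[OF c''[OF ball_U[OF inside[OF that]]]]])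
    from MVT2[OF s this] obtain \<sigma> where \<sigma>: "0 < \<sigma>" "\<sigma> < s"
      and \<psi>_eq: "\<psi> s - \<psi> 0 = (s - 0) * c'' (z + \<tau> *\<^sub>R b + \<sigma> *\<^sub>R a) a b"
      by blast
    have "m * (\<phi> t - \<phi> 0) = t * s * (m * c'' (z + \<tau> *\<^sub>R b + \<sigma> *\<^sub>R a) a b)"
      using \<phi>_eq \<psi>_eq by (simp add: \<psi>_def algebra_simps)
    moreover have "0 < t * s * (m * c'' (z + \<tau> *\<^sub>R b + \<sigma> *\<^sub>R a) a b)"
      using \<sigma> by (intro mult_pos_pos[OF mult_pos_pos[OF t s]] pos inside) auto
    ultimately show "0 < m * (c (z + s *\<^sub>R a + t *\<^sub>R b) - c (z + t *\<^sub>R b) - (c (z + s *\<^sub>R a) - c z))"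
      by (simp only: \<phi>_def scaleR_zero_left add_0_right)
  qed (rule r(1))
qed

section \<open>Small translates of a compact set overlap\<close>

lemma Collect_add_mem_eq_image:
  fixes v :: "'a::ab_group_add"
  shows "{z. z + v \<in> K} = (\<lambda>z. - v + z) ` K"
  by (force simp: image_iff)

text \<open>An open \<open>U\<close> containing \<open>K\<close> with small excess measure contains every small translate
  of \<open>K\<close>; translates have equal measure, so what \<open>K\<close> has outside the translate is as large as
  what the translate has outside \<open>K\<close>, that is, at most the excess.\<close>

lemma measure_compact_diff_translate_small:
  fixes K :: "'a::euclidean_space set"
  assumes K: "compact K" and e: "e > 0"
  obtains d where "d > 0"
    "\<And>v. norm v < d \<Longrightarrow> measure lebesgue (K - {z. z + v \<in> K}) < e"
proof -
  obtain U where U: "open U" "K \<subseteq> U" "U - K \<in> lmeasurable" "emeasure lebesgue (U - K) < ennreal e"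
    using sets_lebesgue_outer_open[OF fmeasurableD[OF lmeasurable_compact[OF K]] e] by blast
  obtain d where d: "d > 0" "(\<Union>x\<in>K. ball x d) \<subseteq> U"
    using compact_subset_open_imp_ball_epsilon_subset[OF K U(1,2)] by blast
  show ?thesis
  proof
    fix v :: 'a assume v: "norm v < d"
    define T where "T = {z. z + v \<in> K}"
    have T_eq: "T = (\<lambda>z. - v + z) ` K"
      unfolding T_def by (rule Collect_add_mem_eq_image)
    have KM: "K \<in> lmeasurable" using K by (rule lmeasurable_compact)
    have TM: "T \<in> lmeasurable" unfolding T_eq using KM by (rule measurable_translation)
    have T_meas: "measure lebesgue T = measure lebesgue K" unfolding T_eq by (rule measure_translation)
    have "T \<subseteq> U"
    proof
      fix z assume "z \<in> T"
      then have "z \<in> ball (z + v) d" "z + v \<in> K" using v by (auto simp: T_def dist_norm)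
      then show "z \<in> U" using d by blast
    qed
    have 1: "measure lebesgue (K \<union> T) = measure lebesgue T + measure lebesgue (K - T)"
      using measure_Un2[OF TM KM] by (simp add: Un_commute)
    have 2: "measure lebesgue (K \<union> T) = measure lebesgue K + measure lebesgue (T - K)"
      using measure_Un2[OF KM TM] by simp
    have "measure lebesgue (T - K) \<le> measure lebesgue (U - K)"
      using \<open>T \<subseteq> U\<close> KM TM U by (intro measure_mono_fmeasurable) auto
    also have "\<dots> < e"
      using U by (simp add: emeasure_eq_measure2 ennreal_less_iff)
    finally show "measure lebesgue (K - {z. z + v \<in> K}) < e"
      using 1 2 T_meas by (simp add: T_def)
  qed (rule d(1))
qed

text \<open>Each of the at most \<open>N\<close> shifts discards less than \<open>1 / (N + 1)\<close> of the measure
  of \<open>K\<close>.\<close>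

lemma translates_of_compact_intersect:
  fixes K :: "'a::euclidean_space set"
  assumes K: "compact K" "\<not> negligible K"
  obtains d where "d > 0"
    "\<And>V. finite V \<Longrightarrow> card V \<le> N \<Longrightarrow> (\<And>v. v \<in> V \<Longrightarrow> norm v < d) \<Longrightarrow>
       \<not> negligible {z \<in> K. \<forall>v\<in>V. z + v \<in> K}"
proof -
  define \<mu> where "\<mu> = measure lebesgue K"
  have KM: "K \<in> lmeasurable" using K(1) by (rule lmeasurable_compact)
  have "\<mu> > 0" using K(2) KM by (simp add: \<mu>_def negligible_iff_measure0 zero_less_measure_iff)
  then have "\<mu> / (N + 1) > 0" by simp
  then obtain d where d: "d > 0"
    and small: "\<And>v. norm v < d \<Longrightarrow> measure lebesgue (K - {z. z + v \<in> K}) < \<mu> / (N + 1)"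
    using measure_compact_diff_translate_small[OF K(1)] by blast
  show ?thesis
  proof
    fix V :: "'a set" assume V: "finite V" "card V \<le> N" "\<And>v. v \<in> V \<Longrightarrow> norm v < d"
    define F where "F = {z \<in> K. \<forall>v\<in>V. z + v \<in> K}"
    define B where "B v = K - {z. z + v \<in> K}" for v
    have "\<not> negligible F"
    proof
      assume "negligible F"
      then have F: "F \<in> lmeasurable" "measure lebesgue F = 0"
        by (simp_all add: negligible_iff_measure)
      have B: "B v \<in> lmeasurable" for v
        unfolding B_def Collect_add_mem_eq_image
        using KM measurable_translation[OF KM] by (rule fmeasurable.Diff)
      have UB: "(\<Union>v\<in>V. B v) \<in> lmeasurable" using B V(1) by (intro fmeasurable.finite_UN)
      have "\<mu> \<le> measure lebesgue (F \<union> (\<Union>v\<in>V. B v))"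
        unfolding \<mu>_def using KM F(1) UB
        by (intro measure_mono_fmeasurable fmeasurable.Un) (auto simp: F_def B_def)
      also have "\<dots> \<le> measure lebesgue F + measure lebesgue (\<Union>v\<in>V. B v)"
        using F UB by (intro measure_Un_le) auto
      also have "\<dots> \<le> measure lebesgue F + (\<Sum>v\<in>V. measure lebesgue (B v))"
        using B V(1) by (intro add_left_mono measure_UNION_le) auto
      also have "\<dots> \<le> 0 + (\<Sum>v\<in>V. \<mu> / (N + 1))"
        unfolding F(2) B_def using small V(3) by (intro add_left_mono sum_mono less_imp_le) auto
      also have "\<dots> \<le> N * (\<mu> / (N + 1))"
        using V(2) \<open>\<mu> > 0\<close> by (simp add: mult_right_mono divide_right_mono)
      also have "\<dots> < \<mu>" using \<open>\<mu> > 0\<close> by (simp add: field_simps)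
      finally show False by simp
    qed
    then show "\<not> negligible {z \<in> K. \<forall>v\<in>V. z + v \<in> K}" by (simp add: F_def)
  qed (rule d)
qed

section \<open>Exchanging mass between the corners of a parallelogram\<close>

lemma has_bochner_integral_lborel_translate:
  fixes u :: "'a::euclidean_space \<Rightarrow> real"
  assumes "has_bochner_integral lborel u I"
  shows "has_bochner_integral lborel (\<lambda>z. u (v + z)) I"
proof -
  have [measurable]: "u \<in> borel_measurable borel" using assms by (auto simp: has_bochner_integral_iff)
  have "has_bochner_integral (distr lborel borel ((+) v)) u I"
    using assms by (simp add: lborel_distr_plus)
  then show ?thesis
    by (simp add: has_bochner_integral_iff integrable_distr_eq integral_distr)
qed

lemma has_bochner_integral_lborel_imp_lebesgue:
  fixes u :: "'a::euclidean_space \<Rightarrow> real"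
  assumes "has_bochner_integral lborel u I"
  shows "has_bochner_integral lebesgue u I"
  using assms by (auto simp: has_bochner_integral_iff integrable_completion integral_completion)

text \<open>For each \<open>w \<in> F\<close>, mass is added at \<open>w\<close> and \<open>w + p + q\<close> and removed at \<open>w + p\<close> and \<open>w + q\<close>.\<close>

definition corner_exchange :: "'a::ab_group_add set \<Rightarrow> 'a \<Rightarrow> 'a \<Rightarrow> 'a \<Rightarrow> real" where
  "corner_exchange F p q z =
     indicator F z - indicator F (z - p) - indicator F (z - q) + indicator F (z - p - q)"

lemma abs_corner_exchange_le: "\<bar>corner_exchange F p q z\<bar> \<le> 2"
  by (auto simp: corner_exchange_def indicator_def)

lemma corner_exchange_eq_0:
  assumes "\<And>w. w \<in> F \<Longrightarrow> w \<in> K \<and> w + p \<in> K \<and> w + q \<in> K \<and> w + p + q \<in> K" and "z \<notin> K"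
  shows "corner_exchange F p q z = 0"
  using assms(1)[of z] assms(1)[of "z - p"] assms(1)[of "z - q"] assms(1)[of "z - p - q"] assms(2)
  by (auto simp: corner_exchange_def indicator_def)

lemma has_bochner_integral_difference_translate_zero:
  fixes u :: "'a::euclidean_space \<Rightarrow> real"
  assumes "integrable lborel u"
  shows "has_bochner_integral lebesgue (\<lambda>y. u y - u (y - v)) 0"
proof -
  have u: "has_bochner_integral lborel u (integral\<^sup>L lborel u)"
    using assms by (simp add: has_bochner_integral_iff)
  have "has_bochner_integral lborel (\<lambda>y. u y - u (- v + y)) (integral\<^sup>L lborel u - integral\<^sup>L lborel u)"
    using has_bochner_integral_diff[OF u has_bochner_integral_lborel_translate[OF u]] .
  then show ?thesis
    using has_bochner_integral_lborel_imp_lebesgue by (force simp: add.commute[of "- v"])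
qed

text \<open>On a section with \<open>x\<close> fixed the exchange has the form \<open>u(y) - u(y - q)\<close> with
  \<open>u(y) = 1_F(x, y) - 1_F(x - p, y)\<close>, whose integral vanishes by translation invariance.
  Compactness of \<open>F\<close> makes every section measurable with finite measure, hence the
  marginals vanish for every \<open>x\<close> and \<open>y\<close>, not just almost every one.\<close>

lemma corner_exchange_marginals:
  fixes F :: "('a::euclidean_space \<times> 'b::euclidean_space) set"
  assumes F: "compact F"
  shows "has_bochner_integral lebesgue (\<lambda>y. corner_exchange F (p, 0) (0, q) (x, y)) 0"
    and "has_bochner_integral lebesgue (\<lambda>x. corner_exchange F (p, 0) (0, q) (x, y)) 0"
proof -
  have c1: "compact {y. (x, y) \<in> F}" for x
  proof -
    have "{y. (x, y) \<in> F} = snd ` (F \<inter> {x} \<times> UNIV)" by force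
    moreover have "compact (F \<inter> {x} \<times> UNIV)" using F by (intro compact_Int_closed closed_Times) auto
    ultimately show ?thesis by (simp add: compact_continuous_image continuous_on_snd)
  qed
  have c2: "compact {x. (x, y) \<in> F}" for y
  proof -
    have "{x. (x, y) \<in> F} = fst ` (F \<inter> UNIV \<times> {y})" by force
    moreover have "compact (F \<inter> UNIV \<times> {y})" using F by (intro compact_Int_closed closed_Times) auto
    ultimately show ?thesis by (simp add: compact_continuous_image continuous_on_fst)
  qed
  have "integrable lborel (\<lambda>y. indicator F (x, y) :: real)" for x
    using borel_integrable_compact[OF c1[of x] continuous_on_const[of _ "1::real"]]
    by (simp add: indicator_def of_bool_def)
  then have i1: "integrable lborel (\<lambda>y. indicator F (x, y) - indicator F (x', y) :: real)" for x x'
    by (intro Bochner_Integration.integrable_diff)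
  have "integrable lborel (\<lambda>x. indicator F (x, y) :: real)" for y
    using borel_integrable_compact[OF c2[of y] continuous_on_const[of _ "1::real"]]
    by (simp add: indicator_def of_bool_def)
  then have i2: "integrable lborel (\<lambda>x. indicator F (x, y) - indicator F (x, y') :: real)" for y y'
    by (intro Bochner_Integration.integrable_diff)
  show "has_bochner_integral lebesgue (\<lambda>y. corner_exchange F (p, 0) (0, q) (x, y)) 0"
    using has_bochner_integral_difference_translate_zero[OF i1[of x "x - p"], of q]
    by (simp add: corner_exchange_def algebra_simps)
  show "has_bochner_integral lebesgue (\<lambda>x. corner_exchange F (p, 0) (0, q) (x, y)) 0"
    using has_bochner_integral_difference_translate_zero[OF i2[of y "y - q"], of p]
    by (simp add: corner_exchange_def algebra_simps)
qed

text \<open>Substituting \<open>z + v\<close> for \<open>z\<close> in each of the four terms moves the shifts from the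
  indicator of \<open>F\<close> to \<open>c\<close>.\<close>

lemma integral_mult_corner_exchange:
  fixes c :: "'a::euclidean_space \<Rightarrow> real"
  assumes F: "compact F" and K: "\<And>w. w \<in> F \<Longrightarrow> w \<in> K \<and> w + p \<in> K \<and> w + q \<in> K \<and> w + p + q \<in> K"
    and c: "continuous_on K c"
  shows "\<exists>I. has_bochner_integral lebesgue (\<lambda>z. c z * corner_exchange F p q z) I \<and>
    has_bochner_integral lebesgue
      (\<lambda>z. indicator F z * (c (z + p + q) - c (z + q) - (c (z + p) - c z))) I"
proof -
  define I where "I v = (LINT z|lborel. indicator F z * c (z + v))" for v
  have *: "has_bochner_integral lebesgue (\<lambda>z. indicator F z * c (z + v)) (I v)"
    "has_bochner_integral lebesgue (\<lambda>z. c z * indicator F (z - v)) (I v)"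
    if v: "\<And>w. w \<in> F \<Longrightarrow> w + v \<in> K" for v
  proof -
    have "continuous_on F (\<lambda>z. c (z + v))"
      by (rule continuous_on_compose2[OF c]) (auto intro!: continuous_intros v)
    then have int: "has_bochner_integral lborel (\<lambda>z. indicator F z * c (z + v)) (I v)"
      using borel_integrable_compact[OF F, of "\<lambda>z. c (z + v)"]
      by (simp add: I_def has_bochner_integral_iff)
    then show "has_bochner_integral lebesgue (\<lambda>z. indicator F z * c (z + v)) (I v)"
      by (rule has_bochner_integral_lborel_imp_lebesgue)
    show "has_bochner_integral lebesgue (\<lambda>z. c z * indicator F (z - v)) (I v)"
      using has_bochner_integral_lborel_imp_lebesgue[OF has_bochner_integral_lborel_translate[OF int, of "- v"]]
      by (simp add: algebra_simps)
  qed
  note v0 = *[of 0] and vp = *[of p] and vq = *[of q] and vpq = *[of "p + q"]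
  have "has_bochner_integral lebesgue (\<lambda>z. c z * indicator F z - c z * indicator F (z - p)
           - c z * indicator F (z - q) + c z * indicator F (z - (p + q))) (I 0 - I p - I q + I (p + q))"
    using v0(2) vp(2) vq(2) vpq(2) K
    by (intro has_bochner_integral_add has_bochner_integral_diff) (auto simp: add.assoc)
  moreover have "has_bochner_integral lebesgue (\<lambda>z. indicator F z * c z - indicator F z * c (z + p)
           - indicator F z * c (z + q) + indicator F z * c (z + (p + q))) (I 0 - I p - I q + I (p + q))"
    using v0(1) vp(1) vq(1) vpq(1) K
    by (intro has_bochner_integral_add has_bochner_integral_diff) (auto simp: add.assoc)
  ultimately show ?thesis
    by (intro exI[of _ "I 0 - I p - I q + I (p + q)"])
       (simp add: corner_exchange_def algebra_simps)
qed

section \<open>Optimal plans saturate the capacity\<close>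

lemma nonnegligible_contains_compact:
  fixes S :: "'a::euclidean_space set"
  assumes S: "S \<in> sets lebesgue" "bounded S" "\<not> negligible S"
  obtains K where "compact K" "K \<subseteq> S" "\<not> negligible K"
proof -
  have SM: "S \<in> lmeasurable" using S(1,2) by (simp add: bounded_set_imp_lmeasurable)
  then have pos: "0 < measure lebesgue S"
    using S(3) by (simp add: negligible_iff_measure0 zero_less_measure_iff)
  obtain T where T: "closed T" "T \<subseteq> S" "S - T \<in> lmeasurable"
    and less: "emeasure lebesgue (S - T) < ennreal (measure lebesgue S)"
    using sets_lebesgue_inner_closed[OF S(1) pos] by blast
  have "\<not> negligible T"
  proof
    assume "negligible T"
    then have "emeasure lebesgue (S - T) = emeasure lebesgue S"
      using S(1) by (simp add: emeasure_Diff_null_set negligible_iff_null_sets)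
    then show False using less SM by (simp add: emeasure_eq_measure2)
  qed
  moreover have "compact T"
    using T(1,2) S(2) by (auto simp: compact_eq_bounded_closed intro: bounded_subset)
  ultimately show ?thesis using that T(2) by blast
qed

lemma borel_measurable_lebesgue_continuous_off_negligible:
  fixes c :: "'a::euclidean_space \<Rightarrow> real"
  assumes "closed Z" "negligible Z" "continuous_on (- Z) c"
  shows "c \<in> borel_measurable lebesgue"
proof -
  have "(\<lambda>z. indicator (- Z) z *\<^sub>R c z) \<in> borel_measurable borel"
    using assms by (intro borel_measurable_continuous_on_indicator) auto
  then have "(\<lambda>z. indicator (- Z) z *\<^sub>R c z) \<in> borel_measurable lebesgue"
    by (intro measurable_completion) simp
  moreover have "AE z in lebesgue. z \<notin> Z"
    using assms(2) by (simp add: AE_not_in negligible_iff_null_sets)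
  then have "AE z in lebesgue. indicator (- Z) z *\<^sub>R c z = c z"
    by eventually_elim simp
  ultimately show ?thesis by (rule borel_measurable_AE)
qed

text \<open>The exchange is bounded by \<open>2\<close> and vanishes off \<open>K\<close>, while on \<open>K\<close> the plan \<open>h\<close> keeps a
  distance \<open>\<delta>\<close> from both bounds.\<close>

lemma transport_plans_add_corner_exchange:
  assumes h: "h \<in> transport_plans f g hbar" and F: "compact F"
    and F_K: "\<And>w. w \<in> F \<Longrightarrow> w \<in> K \<and> w + (p, 0) \<in> K \<and> w + (0, q) \<in> K \<and> w + (p, 0) + (0, q) \<in> K"
    and room: "\<And>z. z \<in> K \<Longrightarrow> \<delta> \<le> h z \<and> h z \<le> hbar z - \<delta>"
    and \<epsilon>: "2 * \<bar>\<epsilon>\<bar> \<le> \<delta>"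
  shows "(\<lambda>z. h z + \<epsilon> * corner_exchange F (p, 0) (0, q) z) \<in> transport_plans f g hbar"
proof -
  let ?\<phi> = "corner_exchange F (p, 0) (0, q)"
  have "integrable lebesgue ?\<phi>"
    using integral_mult_corner_exchange[OF F F_K, of "\<lambda>_. 1"] by (auto simp: has_bochner_integral_iff)
  then have "integrable lebesgue (\<lambda>z. h z + \<epsilon> * ?\<phi> z)"
    using h by (auto simp: transport_plans_def nonneg_L1_def)
  moreover have "\<bar>\<epsilon> * ?\<phi> z\<bar> \<le> \<delta>" for z
  proof -
    have "\<bar>\<epsilon> * ?\<phi> z\<bar> \<le> \<bar>\<epsilon>\<bar> * 2"
      unfolding abs_mult by (rule mult_left_mono[OF abs_corner_exchange_le]) simp
    then show ?thesis using \<epsilon> by simp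
  qed
  then have bounds: "0 \<le> h z + \<epsilon> * ?\<phi> z \<and> h z + \<epsilon> * ?\<phi> z \<le> hbar z"
    if "0 \<le> h z" "h z \<le> hbar z" for z
  proof (cases "z \<in> K")
    case True
    then show ?thesis using room[OF True] \<open>\<And>z. \<bar>\<epsilon> * ?\<phi> z\<bar> \<le> \<delta>\<close>[of z] by linarith
  next
    case False
    then show ?thesis using that corner_exchange_eq_0[OF F_K False] by simp
  qed
  have "AE z in lebesgue. 0 \<le> h z" "AE z in lebesgue. h z \<le> hbar z"
    using h by (auto simp: transport_plans_def nonneg_L1_def)
  then have "AE z in lebesgue. 0 \<le> h z + \<epsilon> * ?\<phi> z \<and> h z + \<epsilon> * ?\<phi> z \<le> hbar z"
    by eventually_elim (rule bounds)
  moreover have add: "has_bochner_integral lebesgue (\<lambda>y. u y + \<epsilon> * v y) a"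
    if "has_bochner_integral lebesgue u a" "has_bochner_integral lebesgue v 0"
    for u v :: "'b::euclidean_space \<Rightarrow> real" and a
    using has_bochner_integral_add[OF that(1) has_bochner_integral_mult_right[OF that(2), of \<epsilon>]] by simp
  have "AE x in lebesgue. has_bochner_integral lebesgue (\<lambda>y. h (x, y)) (f x)"
    "AE y in lebesgue. has_bochner_integral lebesgue (\<lambda>x. h (x, y)) (g y)"
    using h by (auto simp: transport_plans_def)
  note marginals = this
  have "AE x in lebesgue. has_bochner_integral lebesgue (\<lambda>y. h (x, y) + \<epsilon> * ?\<phi> (x, y)) (f x)"
    using marginals(1) by eventually_elim (rule add[OF _ corner_exchange_marginals(1)[OF F]])
  moreover have "AE y in lebesgue. has_bochner_integral lebesgue (\<lambda>x. h (x, y) + \<epsilon> * ?\<phi> (x, y)) (g y)"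
    using marginals(2) by eventually_elim (rule add[OF _ corner_exchange_marginals(2)[OF F]])
  ultimately show ?thesis
    by (auto simp: transport_plans_def nonneg_L1_def)
qed

text \<open>The set where \<open>0 < h < hbar\<close> is, up to null sets, the countable union of the sets \<open>E n\<close>
  on which there is room \<open>1/(n+1)\<close> on both sides. Negligibility of \<open>E n\<close> is a local property,
  and near a point of \<open>E n\<close> a corner exchange on a non-negligible piece would lower the
  cost.\<close>

lemma optimal_plan_saturates_capacity:
  fixes c hbar :: "(real^'d) \<times> (real^'d) \<Rightarrow> real"
  assumes c_bounded: "bounded (range c)"
    and Z_closed: "closed Z"
    and Z_negligible: "negligible Z"
    and c_C2: "C2_on c (- Z)"
    and c_nondegenerate: "\<And>x y. (x, y) \<notin> Z \<Longrightarrow> mixed_partials c x y \<noteq> 0"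
    and hbar: "nonneg_L1 hbar"
    and opt: "is_arg_min (transport_cost c) (\<lambda>k. k \<in> transport_plans f g hbar) h"
  shows "AE z in lebesgue. h z = 0 \<or> h z = hbar z"
proof -
  obtain c' c'' where c': "\<And>z. z \<in> - Z \<Longrightarrow> (c has_derivative blinfun_apply (c' z)) (at z)"
    and c'': "\<And>z. z \<in> - Z \<Longrightarrow> (c' has_derivative blinfun_apply (c'' z)) (at z)"
    and c''_cont: "continuous_on (- Z) c''"
    using c_C2 unfolding C2_on_def by blast
  have Z_open: "open (- Z)" using Z_closed by (simp add: open_Compl)
  have c_cont: "continuous_on (- Z) c"
    using c' by (intro continuous_at_imp_continuous_on ballI has_derivative_continuous)
  have c_meas: "c \<in> borel_measurable lebesgue"
    by (rule borel_measurable_lebesgue_continuous_off_negligible[OF Z_closed Z_negligible c_cont])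
  obtain C where C: "\<And>z. \<bar>c z\<bar> \<le> C" using c_bounded by (auto simp: bounded_iff)
  have h: "h \<in> transport_plans f g hbar"
    and h_min: "\<And>k. k \<in> transport_plans f g hbar \<Longrightarrow> transport_cost c h \<le> transport_cost c k"
    using opt by (auto simp: is_arg_min_def not_less)
  have h_int: "integrable lebesgue h" using h by (simp add: transport_plans_def nonneg_L1_def)
  have [measurable]: "h \<in> borel_measurable lebesgue" "hbar \<in> borel_measurable lebesgue"
    using h_int hbar by (auto simp: nonneg_L1_def)
  define E where "E n = {z. z \<notin> Z \<and> 1 / Suc n \<le> h z \<and> h z \<le> hbar z - 1 / Suc n}" for n
  have E_sets: "E n \<in> sets lebesgue" for n
  proof -
    have "{z \<in> space lebesgue. 1 / Suc n \<le> h z \<and> h z \<le> hbar z - 1 / Suc n} \<in> sets lebesgue"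
      by measurable
    then have "{z \<in> space lebesgue. 1 / Suc n \<le> h z \<and> h z \<le> hbar z - 1 / Suc n} - Z \<in> sets lebesgue"
      using negligible_imp_sets[OF Z_negligible] by (rule sets.Diff)
    then show ?thesis by (simp add: E_def set_diff_eq conj_commute conj_left_commute)
  qed
  have E_negligible: "negligible (E n)" for n
  proof (subst locally_negligible_alt, intro ballI)
    fix z0 assume z0: "z0 \<in> E n"
    obtain x0 y0 where z0_eq: "z0 = (x0, y0)" by fastforce
    have z0_Z: "z0 \<in> - Z" using z0 by (simp add: E_def)
    then have "mixed_partials c x0 y0 \<noteq> 0" using c_nondegenerate z0_eq by simp
    then obtain i j where ij: "mixed_partials c x0 y0 $ i $ j \<noteq> 0"
      by (auto simp: vec_eq_iff)
    define a where "a = (axis i 1 :: real^'d, 0 :: real^'d)"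
    define b where "b = (0 :: real^'d, axis j 1 :: real^'d)"
    define m where "m = c'' z0 a b"
    have "m \<noteq> 0"
      using ij mixed_partials_eq_second_derivative[OF Z_open z0_Z[unfolded z0_eq] c' c'', of i j]
      by (simp add: m_def z0_eq a_def b_def)
    obtain r where r: "r > 0" "ball z0 r \<subseteq> - Z"
      and sign: "\<And>z s t. \<lbrakk>s > 0; t > 0; {z, z + s *\<^sub>R a, z + t *\<^sub>R b, z + s *\<^sub>R a + t *\<^sub>R b} \<subseteq> ball z0 r\<rbrakk> \<Longrightarrow>
       0 < m * (c (z + s *\<^sub>R a + t *\<^sub>R b) - c (z + t *\<^sub>R b) - (c (z + s *\<^sub>R a) - c z))"
      using second_difference_sign[OF Z_open z0_Z c' c'' c''_cont m_def[symmetric] \<open>m \<noteq> 0\<close>] by metis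
    have "negligible (E n \<inter> ball z0 r)"
    proof (rule ccontr)
      assume "\<not> negligible (E n \<inter> ball z0 r)"
      moreover have "E n \<inter> ball z0 r \<in> sets lebesgue" using E_sets by auto
      moreover have "bounded (E n \<inter> ball z0 r)" by (simp add: bounded_Int)
      ultimately obtain K where K: "compact K" "K \<subseteq> E n \<inter> ball z0 r" "\<not> negligible K"
        using nonnegligible_contains_compact by blast
      obtain d where "d > 0" and d: "\<And>V. finite V \<Longrightarrow> card V \<le> 3 \<Longrightarrow> (\<And>v. v \<in> V \<Longrightarrow> norm v < d) \<Longrightarrow>
          \<not> negligible {z \<in> K. \<forall>v\<in>V. z + v \<in> K}"
        using translates_of_compact_intersect[OF K(1,3), where N = 3] by blast
      \<comment> \<open>The longest of the three shifts has norm at most \<open>2 * s\<close>, which must stay below \<open>d\<close>.\<close>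
      define s where "s = d / 3"
      have s: "s > 0" using \<open>d > 0\<close> by (simp add: s_def)
      define p where "p = s *\<^sub>R axis i (1::real)"
      define q where "q = s *\<^sub>R axis j (1::real)"
      have pa: "(p, 0) = s *\<^sub>R a" and qb: "(0, q) = s *\<^sub>R b" by (simp_all add: p_def q_def a_def b_def)
      define V where "V = {(p, 0), (0, q), (p, 0) + (0, q)}"
      have norms: "norm (p, 0 :: real^'d) = s" "norm (0 :: real^'d, q) = s"
        using s by (simp_all add: norm_Pair p_def q_def norm_axis_1)
      have "norm ((p, 0) + (0, q)) \<le> 2 * s"
        using norm_triangle_ineq[of "(p, 0 :: real^'d)" "(0 :: real^'d, q)"] norms by simp
      then have V_small: "norm v < d" if "v \<in> V" for v
        using that norms s \<open>d > 0\<close> unfolding V_def s_def by fastforce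
      have "finite V" "card V \<le> 3"
        by (auto simp: V_def card_insert_if)
      define F where "F = {z \<in> K. \<forall>v\<in>V. z + v \<in> K}"
      have F_nonnegl: "\<not> negligible F"
        unfolding F_def by (rule d[OF \<open>finite V\<close> \<open>card V \<le> 3\<close> V_small])
      have F_K: "w \<in> K \<and> w + (p, 0) \<in> K \<and> w + (0, q) \<in> K \<and> w + (p, 0) + (0, q) \<in> K" if "w \<in> F" for w
        using that by (auto simp: F_def V_def add.assoc)
      have F_compact: "compact F"
      proof -
        have "F = K \<inter> (\<Inter>v\<in>V. (\<lambda>z. - v + z) ` K)"
          unfolding F_def Collect_add_mem_eq_image[symmetric] by auto
        moreover have "closed (\<Inter>v\<in>V. (\<lambda>z. - v + z) ` K)"
          using K(1) by (intro closed_INT ballI compact_imp_closed compact_translation)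
        ultimately show ?thesis using K(1) by (simp add: compact_Int_closed)
      qed
      define D where "D z = c (z + (p, 0) + (0, q)) - c (z + (0, q)) - (c (z + (p, 0)) - c z)" for z
      have D_sign: "0 < m * D z" if "z \<in> F" for z
      proof -
        have "{z, z + s *\<^sub>R a, z + s *\<^sub>R b, z + s *\<^sub>R a + s *\<^sub>R b} \<subseteq> ball z0 r"
          using F_K[OF that] K(2) unfolding pa qb by blast
        then show ?thesis unfolding D_def pa qb by (rule sign[OF s s])
      qed
      have "continuous_on K c" using c_cont by (rule continuous_on_subset) (use K(2) r(2) in blast)
      then obtain I where cI: "has_bochner_integral lebesgue (\<lambda>z. c z * corner_exchange F (p, 0) (0, q) z) I"
        and DI: "has_bochner_integral lebesgue (\<lambda>z. indicator F z * D z) I"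
        using integral_mult_corner_exchange[OF F_compact F_K] unfolding D_def by blast
      have "I \<noteq> 0"
      proof
        assume "I = 0"
        have mDI: "has_bochner_integral lebesgue (\<lambda>z. m * (indicator F z * D z)) 0"
          using has_bochner_integral_mult_right[OF DI, of m] \<open>I = 0\<close> by simp
        have "AE z in lebesgue. m * (indicator F z * D z) = 0"
        proof (subst integral_nonneg_eq_0_iff_AE[symmetric])
          show "AE z in lebesgue. 0 \<le> m * (indicator F z * D z)"
            using D_sign by (intro always_eventually) (auto simp: indicator_def less_imp_le)
        qed (use mDI in \<open>auto simp: has_bochner_integral_iff\<close>)
        then have "AE z in lebesgue. z \<notin> F"
          by eventually_elim (use D_sign in \<open>force simp: indicator_def\<close>)
        then have "negligible F"
          using fmeasurableD[OF lmeasurable_compact[OF F_compact]]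
          by (simp add: negligible_iff_null_sets AE_iff_null_sets)
        with F_nonnegl show False by contradiction
      qed
      \<comment> \<open>The sign makes the cost decrease, and the size keeps \<open>\<bar>\<epsilon>\<bar>\<close> times the bound \<open>2\<close> on
        the exchange within the room \<open>1 / Suc n\<close>.\<close>
      define \<epsilon> where "\<epsilon> = - sgn I * (1 / Suc n) / 2"
      have "\<epsilon> * I < 0"
        using \<open>I \<noteq> 0\<close> by (auto simp: \<epsilon>_def sgn_if)
      have \<epsilon>_le: "2 * \<bar>\<epsilon>\<bar> \<le> 1 / Suc n"
        by (simp add: \<epsilon>_def abs_mult abs_sgn_eq field_simps)
      let ?k = "\<lambda>z. h z + \<epsilon> * corner_exchange F (p, 0) (0, q) z"
      have "?k \<in> transport_plans f g hbar"
        using K(2) by (intro transport_plans_add_corner_exchange[OF h F_compact F_K _ \<epsilon>_le])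
          (auto simp: E_def)
      then have "transport_cost c h \<le> transport_cost c ?k" by (rule h_min)
      also have "transport_cost c ?k = transport_cost c h + \<epsilon> * I"
      proof -
        have "has_bochner_integral lebesgue (\<lambda>z. c z * h z) (transport_cost c h)"
          using integrable_bounded_mult[OF h_int c_meas C] by (simp add: transport_cost_def has_bochner_integral_iff)
        then have "has_bochner_integral lebesgue
            (\<lambda>z. c z * h z + \<epsilon> * (c z * corner_exchange F (p, 0) (0, q) z)) (transport_cost c h + \<epsilon> * I)"
          by (intro has_bochner_integral_add has_bochner_integral_mult_right cI)
        then show ?thesis
          by (simp add: transport_cost_def has_bochner_integral_iff algebra_simps)
      qed
      finally show False using \<open>\<epsilon> * I < 0\<close> by simp
    qed
    then show "\<exists>U. openin (top_of_set (E n)) U \<and> z0 \<in> U \<and> negligible U"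
      using z0 r(1) by (intro exI[of _ "E n \<inter> ball z0 r"]) (auto intro: openin_open_Int)
  qed
  have "AE z in lebesgue. z \<notin> E n" for n
    using E_negligible by (simp add: AE_not_in negligible_iff_null_sets)
  then have "AE z in lebesgue. \<forall>n. z \<notin> E n" by (simp add: AE_all_countable)
  moreover have "AE z in lebesgue. z \<notin> Z"
    using Z_negligible by (simp add: AE_not_in negligible_iff_null_sets)
  moreover have "AE z in lebesgue. 0 \<le> h z" "AE z in lebesgue. h z \<le> hbar z"
    using h by (auto simp: transport_plans_def nonneg_L1_def)
  ultimately show ?thesis
  proof eventually_elim
    case (elim z)
    show ?case
    proof (rule ccontr)
      assume "\<not> (h z = 0 \<or> h z = hbar z)"
      then have "0 < min (h z) (hbar z - h z)" using elim by auto
      then obtain n where "inverse (real (Suc n)) < min (h z) (hbar z - h z)"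
        using reals_Archimedean by blast
      then have "z \<in> E n" using elim(2) by (simp add: E_def inverse_eq_divide)
      then show False using elim(1) by blast
    qed
  qed
qed

theorem corollary3p4:
  fixes c hbar :: "(real^'d) \<times> (real^'d) \<Rightarrow> real"
    and f g :: "real^'d \<Rightarrow> real"
    and Z :: "((real^'d) \<times> (real^'d)) set"
  assumes c_bounded: "bounded (range c)"
    and Z_closed: "closed Z"
    and Z_negligible: "negligible Z"
    and c_C2: "C2_on c (- Z)"
    and c_nondegenerate: "\<And>x y. (x, y) \<notin> Z \<Longrightarrow> det (mixed_partials c x y) \<noteq> 0"
    and hbar: "nonneg_L1 hbar"
    and f: "nonneg_L1 f"
    and g: "nonneg_L1 g"
    and equal_mass: "(LINT x|lebesgue. f x) = (LINT y|lebesgue. g y)"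
    and nonempty: "transport_plans f g hbar \<noteq> {}"
  shows "\<exists>h. is_arg_min (transport_cost c) (\<lambda>k. k \<in> transport_plans f g hbar) h \<and>
             (\<forall>h'. is_arg_min (transport_cost c) (\<lambda>k. k \<in> transport_plans f g hbar) h' \<longrightarrow>
                   (AE z in lebesgue. h' z = h z))"
proof -
  let ?\<Gamma> = "transport_plans f g hbar"
  have "continuous_on (- Z) c"
    using c_C2 unfolding C2_on_def
    by (metis continuous_at_imp_continuous_on has_derivative_continuous)
  then have c_meas: "c \<in> borel_measurable lebesgue"
    by (rule borel_measurable_lebesgue_continuous_off_negligible[OF Z_closed Z_negligible])
  obtain C where C: "\<And>z. \<bar>c z\<bar> \<le> C" using c_bounded by (auto simp: bounded_iff)
  have \<Gamma>_bounds: "AE z in lebesgue. 0 \<le> k z \<and> k z \<le> hbar z" if "k \<in> ?\<Gamma>" for k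
    using that by (auto simp: transport_plans_def nonneg_L1_def)
  have \<Gamma>_int: "integrable lebesgue k" if "k \<in> ?\<Gamma>" for k
    using that by (simp add: transport_plans_def nonneg_L1_def)
  have "\<exists>h\<in>?\<Gamma>. \<forall>k\<in>?\<Gamma>. transport_cost c h \<le> transport_cost c k"
    unfolding transport_cost_def
  proof (rule minimum_attained_on_AE_closed_midpoint_convex_set[where H = hbar])
    show "integrable lebesgue hbar" using hbar by (simp add: nonneg_L1_def)
    show "k \<in> borel_measurable lebesgue" if "k \<in> ?\<Gamma>" for k using \<Gamma>_int[OF that] by auto
    show "l \<in> ?\<Gamma>" if "\<And>n. k n \<in> ?\<Gamma>" "l \<in> borel_measurable lebesgue"
      "AE z in lebesgue. (\<lambda>n. k n z) \<longlonglongrightarrow> l z" for k l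
      by (rule transport_plans_AE_closed[OF hbar that])
  qed (fact c_meas C \<Gamma>_bounds transport_plans_midpoint nonempty)+
  then obtain h where h: "h \<in> ?\<Gamma>" and h_le: "\<And>k. k \<in> ?\<Gamma> \<Longrightarrow> transport_cost c h \<le> transport_cost c k"
    by blast
  have h_opt: "is_arg_min (transport_cost c) (\<lambda>k. k \<in> ?\<Gamma>) h"
    using h h_le by (auto simp: is_arg_min_def not_less)
  have nondegenerate: "mixed_partials c x y \<noteq> 0" if "(x, y) \<notin> Z" for x y
    using c_nondegenerate[OF that] det_0 by (metis mat_0)
  have saturates: "AE z in lebesgue. k z = 0 \<or> k z = hbar z"
    if "is_arg_min (transport_cost c) (\<lambda>k. k \<in> ?\<Gamma>) k" for k
    by (rule optimal_plan_saturates_capacity[OF c_bounded Z_closed Z_negligible c_C2 _ hbar that])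
      (rule nondegenerate)
  have "AE z in lebesgue. h' z = h z" if h'_opt: "is_arg_min (transport_cost c) (\<lambda>k. k \<in> ?\<Gamma>) h'" for h'
  proof -
    let ?mid = "\<lambda>z. (h z + h' z) / 2"
    have h': "h' \<in> ?\<Gamma>" using h'_opt by (simp add: is_arg_min_def)
    have h'_le: "transport_cost c h' \<le> transport_cost c h"
      using h'_opt h by (auto simp: is_arg_min_def not_less)
    have "transport_cost c ?mid = (LINT z|lebesgue. (c z * h z + c z * h' z) / 2)"
      unfolding transport_cost_def by (intro Bochner_Integration.integral_cong) (auto simp: algebra_simps)
    also have "\<dots> = (transport_cost c h + transport_cost c h') / 2"
      using integrable_bounded_mult[OF \<Gamma>_int[OF h] c_meas C] integrable_bounded_mult[OF \<Gamma>_int[OF h'] c_meas C]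
      by (simp add: transport_cost_def)
    finally have "transport_cost c ?mid \<le> transport_cost c h" using h'_le by simp
    then have "is_arg_min (transport_cost c) (\<lambda>k. k \<in> ?\<Gamma>) ?mid"
      using transport_plans_midpoint[OF h h'] h_le by (force simp: is_arg_min_def)
    from saturates[OF this] \<Gamma>_bounds[OF h] \<Gamma>_bounds[OF h']
    show ?thesis by eventually_elim auto
  qed
  then show ?thesis using h_opt by blast
qed

end
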